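(* Let $n\geq2$. Let $F_0(x,y)$ be a fixed function, and let $\varepsilon\neq0$, $a$, $b$, $c$, $d$ be arbitrary constants. (a) The function $F(x,y)=\varepsilon F_0(ax+b,\,cy+d)$ is equivalent to the function $Q_n(z,w)=F_0\left(b+\frac{az}{\varepsilon},\,d+w\right)$ if $c\neq0$, and to $Q_n(z,w)=0$ if $c=0$. (b) The function $F(x,y)=F_0(x,y)+A(x)\,y+B(x)$, where $A(x)$ and $B(x)$ are given functions, is equivalent to the function $$Q_n(z,w)=F_0\left(z,\ \varepsilon\exp\left(\int_{z_0}^z-B(t)\,dt\right)w\right)+\varepsilon\exp\left(\int_{z_0}^z-B(t)\,dt\right)A(z)\,w.$$ (c) The function $F(x,y)=F_0(x,A(x)\,y)$, where $A(x)$ is a given nonzero function, is equivalent to the function $Q_n(z,w)=F_0(z,w)-A_z(z)/A(z)$.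
   Context: For a scalar function $F=F(x,y)$, the operator $\Omega_F=\frac{d}{dx}+F(x,y)$ acts, for $y=y(x)$, by $\Omega_F[u]=\frac{du}{dx}+F(x,y(x))\,u$ (the coefficient $F$ always being evaluated at the original unknown $y$); $\Omega_F^n[y]$ denotes the $n$-fold iterate applied to $y$. $F$ is called the parameter function of the equation $\Omega_F^n[y]=0$. Similarly $\Omega_Q^n[w]$, with $w=w(z)$ and $Q=Q(z,w)$, uses $\Omega_Q=\frac{d}{dz}+Q(z,w)$. For fixed $n$, an equivalence transformation of the class of equations $\Omega_F^n[y]=0$ ($F$ arbitrary) is an invertible point transformation $x=\rho(z,w)$, $y=\psi(z,w)$ (with $\rho_z\psi_w-\rho_w\psi_z\neq0$) which transforms every equation $\Omega_F^n[y]=0$ of the class into an equation equivalent (up to a nonvanishing factor) to $\Omega_Q^n[w]=0$ for some function $Q=Q(z,w)$. Two functions $F(x,y)$ and $Q(z,w)$ are called equivalent (for the given $n$) if some equivalence transformation transforms $\Omega_F^n[y]=0$ into $\Omega_Q^n[w]=0$. All functions are assumed sufficiently smooth and considered locally; $z_0$ is a fixed base point; "nonzero function" means nowhere vanishing on the domain considered; $A_z=dA/dz$. *)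

theory Defs
  imports "HOL-Analysis.Analysis" "HOL-Library.Extended_Nat"
begin

text \<open>Classes C^k for finite k, meant for open S; for finite-dimensional domains this is the usual
  notion of k-fold continuous differentiability.\<close>

primrec Ck_on :: "nat \<Rightarrow> 'a::real_normed_vector set \<Rightarrow> ('a \<Rightarrow> 'b::real_normed_vector) \<Rightarrow> bool" where
  "Ck_on 0 S f \<longleftrightarrow> continuous_on S f"
| "Ck_on (Suc k) S f \<longleftrightarrow>
     (\<forall>x\<in>S. f differentiable (at x)) \<and>
     (\<forall>v. Ck_on k S (\<lambda>x. frechet_derivative f (at x) v))"

text \<open>The same for a degree of smoothness that may be infinite.\<close>

definition C_on :: "enat \<Rightarrow> 'a::real_normed_vector set \<Rightarrow> ('a \<Rightarrow> 'b::real_normed_vector) \<Rightarrow> bool" where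
  "C_on r S f \<longleftrightarrow> (\<forall>k. enat k \<le> r \<longrightarrow> Ck_on k S f)"

text \<open>The operator acts on u, while its coefficient is always evaluated along the unknown y.\<close>

definition Omega :: "(real \<times> real \<Rightarrow> real) \<Rightarrow> (real \<Rightarrow> real) \<Rightarrow> (real \<Rightarrow> real) \<Rightarrow> real \<Rightarrow> real" where
  "Omega F y u = (\<lambda>x. deriv u x + F (x, y x) * u x)"

definition Omega_iter :: "nat \<Rightarrow> (real \<times> real \<Rightarrow> real) \<Rightarrow> (real \<Rightarrow> real) \<Rightarrow> real \<Rightarrow> real" where
  "Omega_iter n F y = (Omega F y ^^ n) y"

definition jet :: "nat \<Rightarrow> (real \<Rightarrow> real) \<Rightarrow> real \<Rightarrow> real list" where
  "jet n w z = map (\<lambda>k. (deriv ^^ k) w z) [0..<Suc n]"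

definition jacobian :: "(real \<times> real \<Rightarrow> real) \<Rightarrow> (real \<times> real \<Rightarrow> real) \<Rightarrow> real \<times> real \<Rightarrow> real" where
  "jacobian \<rho> \<psi> = (\<lambda>(z, w).
     deriv (\<lambda>s. \<rho> (s, w)) z * deriv (\<lambda>s. \<psi> (z, s)) w -
     deriv (\<lambda>s. \<rho> (z, s)) w * deriv (\<lambda>s. \<psi> (s, w)) z)"

definition point_transformation ::
  "enat \<Rightarrow> (real \<times> real) set \<Rightarrow> (real \<times> real) set \<Rightarrow>
   (real \<times> real \<Rightarrow> real) \<Rightarrow> (real \<times> real \<Rightarrow> real) \<Rightarrow> bool" where
  "point_transformation r V U \<rho> \<psi> \<longleftrightarrow>
     open V \<and> open U \<and> C_on r V \<rho> \<and> C_on r V \<psi> \<and>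
     bij_betw (\<lambda>p. (\<rho> p, \<psi> p)) V U \<and> (\<forall>p\<in>V. jacobian \<rho> \<psi> p \<noteq> 0)"

text \<open>Substituting x = \<open>\<rho>(z, w)\<close>, y = \<open>\<psi>(z, w)\<close> turns the equation with parameter function F into the one
  with parameter function Q, up to a nonvanishing factor \<open>\<mu>\<close> on the space of n-jets. The image of the
  graph of w is again a graph, that of y, when \<open>\<rho>(z, w(z))\<close> has nonvanishing derivative; y is then
  determined on the image of I, which is all that matters below. No smoothness of \<open>\<mu>\<close> is demanded:
  both sides are affine in the highest derivative, with nonvanishing smooth leading coefficients, so
  that a smooth factor exists as soon as any factor does.\<close>

definition transforms_to ::
  "nat \<Rightarrow> (real \<times> real) set \<Rightarrow> (real \<times> real \<Rightarrow> real) \<Rightarrow> (real \<times> real \<Rightarrow> real) \<Rightarrow>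
   (real \<times> real \<Rightarrow> real) \<Rightarrow> (real \<times> real \<Rightarrow> real) \<Rightarrow> bool" where
  "transforms_to n V \<rho> \<psi> F Q \<longleftrightarrow>
     (\<exists>\<mu> :: real \<Rightarrow> real list \<Rightarrow> real. (\<forall>z j. \<mu> z j \<noteq> 0) \<and>
       (\<forall>I w y. open I \<and> is_interval I \<and> C_on (enat n) I w \<and>
          (\<forall>z\<in>I. (z, w z) \<in> V \<and> deriv (\<lambda>s. \<rho> (s, w s)) z \<noteq> 0 \<and>
                  y (\<rho> (z, w z)) = \<psi> (z, w z)) \<longrightarrow>
          (\<forall>z\<in>I. Omega_iter n F y (\<rho> (z, w z)) = \<mu> z (jet n w z) * Omega_iter n Q w z)))"

text \<open>Parameter functions are of class C^r and point transformations of class C^(r+1), since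
  derivatives of the transformation enter the new parameter function.\<close>

definition equivalence_transformation ::
  "enat \<Rightarrow> nat \<Rightarrow> (real \<times> real) set \<Rightarrow> (real \<times> real) set \<Rightarrow>
   (real \<times> real \<Rightarrow> real) \<Rightarrow> (real \<times> real \<Rightarrow> real) \<Rightarrow> bool" where
  "equivalence_transformation r n V U \<rho> \<psi> \<longleftrightarrow>
     point_transformation (r + 1) V U \<rho> \<psi> \<and>
     (\<forall>F. C_on r U F \<longrightarrow> (\<exists>Q. C_on r V Q \<and> transforms_to n V \<rho> \<psi> F Q))"

definition equivalent ::
  "enat \<Rightarrow> nat \<Rightarrow> (real \<times> real) set \<Rightarrow> (real \<times> real \<Rightarrow> real) \<Rightarrow>
   (real \<times> real) set \<Rightarrow> (real \<times> real \<Rightarrow> real) \<Rightarrow> bool" where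
  "equivalent r n U F V Q \<longleftrightarrow>
     C_on r U F \<and> C_on r V Q \<and>
     (\<exists>\<rho> \<psi>. equivalence_transformation r n V U \<rho> \<psi> \<and> transforms_to n V \<rho> \<psi> F Q)"

end

theory Submission
  imports Defs
begin

text \<open>
  Every equivalence asserted below comes from a single kind of point transformation, \<open>x = s z\<close>,
  \<open>y = \<phi>(z) w\<close> with a constant \<open>s \<noteq> 0\<close> and a nowhere vanishing function \<open>\<phi>\<close>. If \<open>v\<close> is a function of \<open>x\<close>
  and \<open>u\<close> a function of \<open>z\<close> with \<open>v = \<phi> u\<close>, then
  \<open>dv/dx + F v = (\<phi>/s) (du/dz + Q u)\<close> for \<open>Q(z, w) = s F(s z, \<phi>(z) w) + \<phi>'(z)/\<phi>(z)\<close>.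
  The factor \<open>\<phi>/s\<close> is again \<open>\<phi>\<close> times a constant, so the same identity applies to the next iterate:
  by induction the \<open>k\<close>-th iterates for \<open>F\<close> and \<open>Q\<close> differ by the factor \<open>\<phi>/s\<^sup>k\<close>
  (\<open>Omega_iter_transform\<close>). As this works for every \<open>F\<close>, the transformation is an equivalence
  transformation, and it takes \<open>F\<close> to \<open>Q\<close> (\<open>equivalent_pullback_parameter\<close>).

  The theorem is then a matter of choosing \<open>s\<close> and \<open>\<phi>\<close>. For an affine change of arguments,
  \<open>s = 1/\<epsilon>\<close> and \<open>\<phi> = 1/c\<close> absorb \<open>\<epsilon>\<close> and \<open>c\<close>. In the other cases \<open>s = 1\<close>, and the logarithmic derivative of
  \<open>\<phi>\<close> supplies or removes a summand that depends on \<open>z\<close> alone: if \<open>c = 0\<close>, or if a summand \<open>B\<close> is to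
  disappear, \<open>\<phi>\<close> solves \<open>\<phi>' = - F \<phi>\<close> or \<open>\<phi>' = - B \<phi>\<close>; and \<open>\<phi> = 1/A\<close> undoes the rescaling of \<open>y\<close> by \<open>A\<close> at
  the cost of \<open>-A'/A\<close>.

  Two points need care. The derivative of a function is meaningful only where it exists, so the
  induction has to carry along that the \<open>k\<close>-th iterate is of class \<open>C\<close> of order \<open>n - k\<close>; this is where
  the assumption \<open>n \<le> r + 1\<close> enters. And for \<open>c = 0\<close> the domain in \<open>x\<close> may be disconnected, so that \<open>\<phi>\<close>
  has to be built on each component separately.
\<close>

section \<open>Calculus of functions of class C^k\<close>

text \<open>Derivatives are two-sided, so openness of \<open>S\<close> is what makes them depend only on the values of the
  function in \<open>S\<close>.\<close>

lemma Ck_on_cong: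
  assumes "open S" and "\<And>x. x \<in> S \<Longrightarrow> f x = g x"
  shows "Ck_on k S f \<longleftrightarrow> Ck_on k S g"
proof -
  have *: "Ck_on k S g" if "\<And>x. x \<in> S \<Longrightarrow> f x = g x" "Ck_on k S f" for f g :: "'a \<Rightarrow> 'b"
    using that
  proof (induction k arbitrary: f g)
    case 0
    then show ?case using continuous_on_cong by (metis Ck_on.simps(1))
  next
    case (Suc k)
    have D: "(g has_derivative frechet_derivative f (at x)) (at x)" if "x \<in> S" for x
      using Suc.prems that \<open>open S\<close>
      by (metis Ck_on.simps(2) frechet_derivative_works has_derivative_transform_within_open)
    then have "frechet_derivative f (at x) = frechet_derivative g (at x)" if "x \<in> S" for x
      using that frechet_derivative_at by blast
    then have "Ck_on k S (\<lambda>x. frechet_derivative g (at x) v)" for v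
      using Suc.IH[of "\<lambda>x. frechet_derivative f (at x) v" "\<lambda>x. frechet_derivative g (at x) v"] Suc.prems
      by auto
    then show ?case using D by (auto simp: differentiable_def)
  qed
  show ?thesis using assms(2) *[of f g] *[of g f] by auto
qed

lemma Ck_on_SucI:
  assumes "open S" and "\<And>x. x \<in> S \<Longrightarrow> (f has_derivative f' x) (at x)"
    and "\<And>v. Ck_on k S (\<lambda>x. f' x v)"
  shows "Ck_on (Suc k) S f"
proof -
  have "frechet_derivative f (at x) = f' x" if "x \<in> S" for x
    using assms(2)[OF that] frechet_derivative_at by metis
  then have "Ck_on k S (\<lambda>x. frechet_derivative f (at x) v)" for v
    using Ck_on_cong[OF assms(1), of "\<lambda>x. frechet_derivative f (at x) v" "\<lambda>x. f' x v"] assms(3)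
    by auto
  then show ?thesis using assms(2) by (auto simp: differentiable_def)
qed

lemma Ck_on_SucD:
  assumes "Ck_on (Suc k) S f"
  shows "\<And>x. x \<in> S \<Longrightarrow> (f has_derivative frechet_derivative f (at x)) (at x)"
    and "Ck_on k S (\<lambda>x. frechet_derivative f (at x) v)"
  using assms by (auto simp: frechet_derivative_works)

lemma Ck_on_Suc_imp: "Ck_on (Suc k) S f \<Longrightarrow> Ck_on k S f"
proof (induction k arbitrary: f)
  case 0
  then show ?case
    by (simp add: continuous_at_imp_continuous_on differentiable_imp_continuous_within)
next
  case (Suc k)
  then show ?case by (metis Ck_on.simps(2))
qed

lemma Ck_on_mono: "Ck_on k S f \<Longrightarrow> j \<le> k \<Longrightarrow> Ck_on j S f"
  by (induction k) (metis le_0_eq, metis Ck_on_Suc_imp le_Suc_eq)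

lemma Ck_on_subset: "Ck_on k S f \<Longrightarrow> T \<subseteq> S \<Longrightarrow> Ck_on k T f"
  by (induction k arbitrary: f) (auto intro: continuous_on_subset)

lemma Ck_on_const: "open S \<Longrightarrow> Ck_on k S (\<lambda>x. c)"
proof (induction k arbitrary: c)
  case (Suc k)
  then show ?case by (intro Ck_on_SucI[where f' = "\<lambda>_ _. 0"]) (auto intro: has_derivative_const)
qed simp

lemma Ck_on_bounded_linear:
  assumes "bounded_linear L" and "open S" and "Ck_on k S f"
  shows "Ck_on k S (\<lambda>x. L (f x))"
  using assms(3)
proof (induction k arbitrary: f)
  case 0
  then show ?case using bounded_linear.continuous_on[OF assms(1)] by auto
next
  case (Suc k)
  show ?case
    by (rule Ck_on_SucI[OF assms(2) bounded_linear.has_derivative[OF assms(1) Ck_on_SucD(1)[OF Suc.prems]]])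
       (auto intro: Suc.IH Ck_on_SucD(2)[OF Suc.prems])
qed

lemma Ck_on_id: "open S \<Longrightarrow> Ck_on k S (\<lambda>x. x)"
proof (cases k)
  case (Suc j)
  then show "open S \<Longrightarrow> ?thesis"
    using Ck_on_SucI[of S "\<lambda>x. x" "\<lambda>_ v. v" j] by (simp add: Ck_on_const has_derivative_ident del: Ck_on.simps)
qed simp

lemma Ck_on_add:
  assumes "open S" and "Ck_on k S f" and "Ck_on k S g"
  shows "Ck_on k S (\<lambda>x. f x + g x)"
  using assms(2,3)
proof (induction k arbitrary: f g)
  case 0
  then show ?case by (simp add: continuous_intros)
next
  case (Suc k)
  show ?case
    by (rule Ck_on_SucI[OF assms(1) has_derivative_add[OF Ck_on_SucD(1)[OF Suc.prems(1)] Ck_on_SucD(1)[OF Suc.prems(2)]]])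
       (assumption | intro Suc.IH Ck_on_SucD(2) Suc.prems)+
qed

lemma Ck_on_Pair:
  assumes "open S" and "Ck_on k S f" and "Ck_on k S g"
  shows "Ck_on k S (\<lambda>x. (f x, g x))"
  using assms(2,3)
proof (induction k arbitrary: f g)
  case 0
  then show ?case by (simp add: continuous_intros)
next
  case (Suc k)
  show ?case
    by (rule Ck_on_SucI[OF assms(1) has_derivative_Pair[OF Ck_on_SucD(1)[OF Suc.prems(1)] Ck_on_SucD(1)[OF Suc.prems(2)]]])
       (assumption | intro Suc.IH Ck_on_SucD(2) Suc.prems)+
qed

lemma Ck_on_mult:
  fixes f g :: "'a::real_normed_vector \<Rightarrow> real"
  assumes "open S" and "Ck_on k S f" and "Ck_on k S g"
  shows "Ck_on k S (\<lambda>x. f x * g x)"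
  using assms(2,3)
proof (induction k arbitrary: f g)
  case 0
  then show ?case by (simp add: continuous_intros)
next
  case (Suc k)
  show ?case
    by (rule Ck_on_SucI[OF assms(1) has_derivative_mult[OF Ck_on_SucD(1)[OF Suc.prems(1)] Ck_on_SucD(1)[OF Suc.prems(2)]]])
       (assumption | intro Ck_on_add Suc.IH assms(1) Ck_on_SucD(2) Suc.prems
          Ck_on_Suc_imp[OF Suc.prems(1)] Ck_on_Suc_imp[OF Suc.prems(2)])+
qed

lemma Ck_on_sum:
  assumes "open S" and "\<And>i. i \<in> A \<Longrightarrow> Ck_on k S (f i)"
  shows "Ck_on k S (\<lambda>x. \<Sum>i\<in>A. f i x)"
  using assms(2)
  by (induction A rule: infinite_finite_induct) (auto intro: Ck_on_const Ck_on_add assms(1))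

lemma Ck_on_inverse:
  fixes f :: "'a::real_normed_vector \<Rightarrow> real"
  assumes "open S" and "Ck_on k S f" and "\<And>x. x \<in> S \<Longrightarrow> f x \<noteq> 0"
  shows "Ck_on k S (\<lambda>x. inverse (f x))"
  using assms(2)
proof (induction k)
  case 0
  then show ?case using assms(3) by (simp add: continuous_intros)
next
  case (Suc k)
  have IH: "Ck_on k S (\<lambda>x. inverse (f x))"
    using Suc Ck_on_Suc_imp by blast
  have "Ck_on k S (\<lambda>x. - (inverse (f x) * frechet_derivative f (at x) v * inverse (f x)))" for v
    using Ck_on_SucD(2)[OF Suc.prems] IH
    by (intro Ck_on_bounded_linear[OF bounded_linear_minus[OF bounded_linear_ident]] Ck_on_mult assms(1))
  then show ?case
    by (intro Ck_on_SucI[OF assms(1) Deriv.has_derivative_inverse[OF assms(3) Ck_on_SucD(1)[OF Suc.prems]]])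
qed

lemma Ck_on_exp:
  fixes f :: "'a::real_normed_vector \<Rightarrow> real"
  assumes "open S" and "Ck_on k S f"
  shows "Ck_on k S (\<lambda>x. exp (f x))"
  using assms(2)
proof (induction k)
  case 0
  then show ?case by (simp add: continuous_intros)
next
  case (Suc k)
  have D: "((\<lambda>x. exp (f x)) has_derivative (\<lambda>v. exp (f x) * frechet_derivative f (at x) v)) (at x)"
    if "x \<in> S" for x
    using has_derivative_exp[OF Ck_on_SucD(1)[OF Suc.prems that]] by (simp add: mult.commute)
  show ?case
    by (rule Ck_on_SucI[OF assms(1) D])
       (assumption | intro Ck_on_mult Suc.IH Ck_on_SucD(2) Suc.prems Ck_on_Suc_imp[OF Suc.prems] assms(1))+
qed

text \<open>In coordinates the chain rule reads \<open>D(f \<circ> g) v = (\<Sum>i. (Dg v \<bullet> i) * (\<partial>\<^sub>i f \<circ> g))\<close>, which reduces order \<open>k + 1\<close>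
  for \<open>f \<circ> g\<close> to order \<open>k\<close> for the compositions \<open>\<partial>\<^sub>i f \<circ> g\<close>. The finite basis is what makes this
  induction close.\<close>

lemma Ck_on_compose:
  fixes g :: "'a::real_normed_vector \<Rightarrow> 'b::euclidean_space" and f :: "'b \<Rightarrow> real"
  assumes "open S" and "Ck_on k S g" and "g ` S \<subseteq> T" and "Ck_on k T f"
  shows "Ck_on k S (\<lambda>x. f (g x))"
  using assms(2,4)
proof (induction k arbitrary: f)
  case 0
  then show ?case using assms(3) by (auto intro: continuous_on_compose2)
next
  case (Suc k)
  define f' where "f' = (\<lambda>i y. frechet_derivative f (at y) i)"
  define g' where "g' = (\<lambda>v x. frechet_derivative g (at x) v)"
  have D: "((\<lambda>x. f (g x)) has_derivative (\<lambda>v. \<Sum>i\<in>Basis. (g' v x \<bullet> i) * f' i (g x))) (at x)"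
    if "x \<in> S" for x
  proof -
    have f: "(f has_derivative frechet_derivative f (at (g x))) (at (g x))"
      using Ck_on_SucD(1)[OF Suc.prems(2)] that assms(3) by blast
    have "((\<lambda>x. f (g x)) has_derivative (\<lambda>v. frechet_derivative f (at (g x)) (g' v x))) (at x)"
      unfolding g'_def
      using has_derivative_compose[OF Ck_on_SucD(1)[OF Suc.prems(1) that] f] .
    moreover have "frechet_derivative f (at (g x)) u = (\<Sum>i\<in>Basis. (u \<bullet> i) * f' i (g x))" for u
      using Linear_Algebra.linear_componentwise[OF has_derivative_linear[OF f], of u 1] by (simp add: f'_def)
    ultimately show ?thesis by simp
  qed
  have IH: "Ck_on k S (\<lambda>x. f' i (g x))" for i
    using Suc.IH[of "f' i"] Ck_on_SucD(2)[OF Suc.prems(2)] Ck_on_Suc_imp[OF Suc.prems(1)]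
    by (simp add: f'_def)
  have "Ck_on k S (g' v)" for v
    using Ck_on_SucD(2)[OF Suc.prems(1)] by (simp add: g'_def)
  then have "Ck_on k S (\<lambda>x. g' v x \<bullet> i)" for v i
    by (intro Ck_on_bounded_linear[OF bounded_linear_inner_left] assms(1))
  then show ?case
    using IH by (intro Ck_on_SucI[OF assms(1) D] Ck_on_sum Ck_on_mult assms(1))
qed

text \<open>The iterated operators are built from \<^const>\<open>deriv\<close>, whereas the classes \<open>C^k\<close> are built from
  directional derivatives; this is the bridge between the two.\<close>

lemma Ck_on_Suc_real_iff:
  fixes f :: "real \<Rightarrow> real"
  assumes "open S"
  shows "Ck_on (Suc k) S f \<longleftrightarrow>
    (\<forall>x\<in>S. (f has_real_derivative deriv f x) (at x)) \<and> Ck_on k S (deriv f)"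
    (is "?l \<longleftrightarrow> ?r")
proof
  assume ?l
  then have D: "(f has_real_derivative deriv f x) (at x)" if "x \<in> S" for x
    using that by (auto simp: DERIV_deriv_iff_real_differentiable)
  then have "frechet_derivative f (at x) 1 = deriv f x" if "x \<in> S" for x
    using that frechet_derivative_at[of f "(*) (deriv f x)" x] 
    by (metis has_field_derivative_def mult.right_neutral)
  then have "Ck_on k S (deriv f)"
    using Ck_on_cong[OF assms, of "\<lambda>x. frechet_derivative f (at x) 1" "deriv f" k]
      Ck_on_SucD(2)[OF \<open>?l\<close>, of 1] by simp
  with D show ?r by blast
next
  assume ?r
  then show ?l
    by (intro Ck_on_SucI[OF assms, where f' = "\<lambda>x v. deriv f x * v"])
       (auto simp: has_field_derivative_def intro: Ck_on_mult[OF assms _ Ck_on_const[OF assms]])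
qed

lemma C_on_imp_continuous_on: "C_on r S f \<Longrightarrow> continuous_on S f"
  by (metis C_on_def Ck_on.simps(1) zero_enat_def zero_le)

lemma C_on_subset: "C_on r S f \<Longrightarrow> T \<subseteq> S \<Longrightarrow> C_on r T f"
  by (simp add: C_on_def Ck_on_subset[where S = S])

lemma C_on_cong:
  assumes "open S" and "\<And>x. x \<in> S \<Longrightarrow> f x = g x"
  shows "C_on r S f \<longleftrightarrow> C_on r S g"
  using Ck_on_cong[of S f g] assms by (simp add: C_on_def)

lemma Ck_on_fst: "open S \<Longrightarrow> Ck_on k S fst"
  using Ck_on_bounded_linear[OF bounded_linear_fst _ Ck_on_id] .

lemma Ck_on_snd: "open S \<Longrightarrow> Ck_on k S snd"
  using Ck_on_bounded_linear[OF bounded_linear_snd _ Ck_on_id] .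

lemma C_on_compose:
  fixes g :: "'a::real_normed_vector \<Rightarrow> 'b::euclidean_space" and f :: "'b \<Rightarrow> real"
  assumes "open S" and "C_on r S g" and "g ` S \<subseteq> T" and "C_on r T f"
  shows "C_on r S (\<lambda>x. f (g x))"
  using assms Ck_on_compose[OF assms(1) _ assms(3)] by (simp add: C_on_def)

lemma C_on_bounded_linear: "bounded_linear L \<Longrightarrow> open S \<Longrightarrow> C_on r S f \<Longrightarrow> C_on r S (\<lambda>x. L (f x))"
  by (simp add: C_on_def Ck_on_bounded_linear)

lemma C_on_const: "open S \<Longrightarrow> C_on r S (\<lambda>x. c)"
  by (simp add: C_on_def Ck_on_const)

lemma C_on_fst: "open S \<Longrightarrow> C_on r S fst"
  by (simp add: C_on_def Ck_on_fst)

lemma C_on_snd: "open S \<Longrightarrow> C_on r S snd"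
  by (simp add: C_on_def Ck_on_snd)

lemma C_on_id: "open S \<Longrightarrow> C_on r S (\<lambda>x. x)"
  by (simp add: C_on_def Ck_on_id)

lemma C_on_Pair: "open S \<Longrightarrow> C_on r S f \<Longrightarrow> C_on r S g \<Longrightarrow> C_on r S (\<lambda>x. (f x, g x))"
  by (simp add: C_on_def Ck_on_Pair)

lemma C_on_add: "open S \<Longrightarrow> C_on r S f \<Longrightarrow> C_on r S g \<Longrightarrow> C_on r S (\<lambda>x. f x + g x)"
  by (simp add: C_on_def Ck_on_add)

lemma C_on_mult:
  fixes f g :: "'a::real_normed_vector \<Rightarrow> real"
  shows "open S \<Longrightarrow> C_on r S f \<Longrightarrow> C_on r S g \<Longrightarrow> C_on r S (\<lambda>x. f x * g x)"
  by (simp add: C_on_def Ck_on_mult)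

lemma C_on_inverse:
  fixes f :: "'a::real_normed_vector \<Rightarrow> real"
  shows "open S \<Longrightarrow> C_on r S f \<Longrightarrow> (\<And>x. x \<in> S \<Longrightarrow> f x \<noteq> 0) \<Longrightarrow> C_on r S (\<lambda>x. inverse (f x))"
  by (simp add: C_on_def Ck_on_inverse)

lemma C_on_exp:
  fixes f :: "'a::real_normed_vector \<Rightarrow> real"
  shows "open S \<Longrightarrow> C_on r S f \<Longrightarrow> C_on r S (\<lambda>x. exp (f x))"
  by (simp add: C_on_def Ck_on_exp)

lemma C_on_mono: "C_on r S f \<Longrightarrow> q \<le> r \<Longrightarrow> C_on q S f"
  by (auto simp: C_on_def)

lemma enat_Suc_le_plus_one_iff: "enat (Suc k) \<le> r + 1 \<longleftrightarrow> enat k \<le> r"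
  by (cases r) (auto simp: one_enat_def)

lemma C_on_Suc_real_iff:
  fixes f :: "real \<Rightarrow> real"
  assumes "open S"
  shows "C_on (r + 1) S f \<longleftrightarrow>
    (\<forall>x\<in>S. (f has_real_derivative deriv f x) (at x)) \<and> C_on r S (deriv f)"
    (is "?l \<longleftrightarrow> ?r")
proof
  assume l: ?l
  then have *: "Ck_on (Suc k) S f" if "enat k \<le> r" for k
    using that by (simp add: C_on_def enat_Suc_le_plus_one_iff del: Ck_on.simps)
  then show ?r
    using *[of 0] by (auto simp: C_on_def Ck_on_Suc_real_iff[OF assms] zero_enat_def[symmetric] simp del: Ck_on.simps)
next
  assume r: ?r
  have "Ck_on k S f" if "enat k \<le> r + 1" for k
  proof (cases k)
    case 0
    have "continuous_on S f"
      using r DERIV_isCont continuous_at_imp_continuous_on by blast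
    then show ?thesis using 0 by simp
  next
    case (Suc j)
    then show ?thesis
      using that r
      by (simp add: C_on_def enat_Suc_le_plus_one_iff Ck_on_Suc_real_iff[OF assms] del: Ck_on.simps)
  qed
  then show ?l by (simp add: C_on_def)
qed

lemma C_on_antiderivative:
  fixes f :: "real \<Rightarrow> real"
  assumes "open S" and "\<And>x. x \<in> S \<Longrightarrow> (f has_real_derivative g x) (at x)" and "C_on r S g"
  shows "C_on (r + 1) S f"
proof -
  have "deriv f x = g x" if "x \<in> S" for x
    using assms(2)[OF that] by (rule DERIV_imp_deriv)
  then show ?thesis
    using assms C_on_cong[OF assms(1), of "deriv f" g r] by (simp add: C_on_Suc_real_iff)
qed

lemma C_on_comp_fst:
  fixes f :: "real \<Rightarrow> real"
  assumes "open V" and "fst ` V \<subseteq> J" and "C_on r J f"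
  shows "C_on r V (\<lambda>p. f (fst p))"
  using C_on_compose[OF assms(1) C_on_fst[OF assms(1)] assms(2,3)] .

section \<open>Fibrewise linear point transformations\<close>

text \<open>The parameter function of the equation in \<open>(z, w)\<close> obtained by the substitution \<open>x = s z\<close>,
  \<open>y = \<phi>(z) w\<close>.\<close>

definition pullback_parameter ::
  "real \<Rightarrow> (real \<Rightarrow> real) \<Rightarrow> (real \<times> real \<Rightarrow> real) \<Rightarrow> real \<times> real \<Rightarrow> real" where
  "pullback_parameter s \<phi> F = (\<lambda>(z, w). s * F (s * z, \<phi> z * w) + deriv \<phi> z / \<phi> z)"

lemma C_on_pullback_parameter:
  assumes "open V" and "open J" and "fst ` V \<subseteq> J"
    and \<phi>: "C_on (r + 1) J \<phi>" "\<And>x. x \<in> J \<Longrightarrow> \<phi> x \<noteq> 0"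
    and maps: "\<And>z w. (z, w) \<in> V \<Longrightarrow> (s * z, \<phi> z * w) \<in> U"
    and "C_on r U F"
  shows "C_on r V (pullback_parameter s \<phi> F)"
proof -
  note V = \<open>open V\<close>
  have \<phi>V: "C_on r V (\<lambda>p. \<phi> (fst p))"
    using C_on_comp_fst[OF V \<open>fst ` V \<subseteq> J\<close>] C_on_mono[OF \<phi>(1)] by (simp add: add_increasing2)
  have "C_on r V (\<lambda>p. deriv \<phi> (fst p))"
    using C_on_comp_fst[OF V \<open>fst ` V \<subseteq> J\<close>] \<phi>(1) by (simp add: C_on_Suc_real_iff[OF \<open>open J\<close>])
  moreover have "C_on r V (\<lambda>p. inverse (\<phi> (fst p)))"
    using C_on_inverse[OF V \<phi>V] \<phi>(2) \<open>fst ` V \<subseteq> J\<close> by blast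
  moreover have "C_on r V (\<lambda>p. F (s * fst p, \<phi> (fst p) * snd p))"
  proof (rule C_on_compose[OF V _ _ \<open>C_on r U F\<close>])
    show "C_on r V (\<lambda>p. (s * fst p, \<phi> (fst p) * snd p))"
      by (intro C_on_Pair C_on_mult C_on_const C_on_fst C_on_snd \<phi>V V)
  qed (use maps in auto)
  ultimately have "C_on r V (\<lambda>p. s * F (s * fst p, \<phi> (fst p) * snd p) + deriv \<phi> (fst p) * inverse (\<phi> (fst p)))"
    by (intro C_on_add C_on_mult C_on_const V)
  then show ?thesis by (simp add: pullback_parameter_def case_prod_unfold divide_inverse)
qed

text \<open>Each application of the operator costs one derivative. The coefficient \<open>Q(z, w(z))\<close> is needed only
  to order \<open>n - 1\<close>, because it enters with the first application.\<close>

lemma Omega_iter_smooth: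
  assumes "open I" and w: "Ck_on n I w" and "C_on r V Q" and "enat n \<le> r + 1"
    and graph: "\<And>z. z \<in> I \<Longrightarrow> (z, w z) \<in> V"
  shows "k \<le> n \<Longrightarrow> Ck_on (n - k) I ((Omega Q w ^^ k) w)"
proof (induction k)
  case 0
  then show ?case using w by simp
next
  case (Suc k)
  define m where "m = n - Suc k"
  have m: "n - k = Suc m" "n - Suc k = m" using Suc.prems by (auto simp: m_def)
  have "enat (Suc m) \<le> r + 1" 
    using Suc.prems by (intro order_trans[OF _ \<open>enat n \<le> r + 1\<close>]) (simp add: m_def)
  then have Q: "Ck_on m V Q"
    using \<open>C_on r V Q\<close> by (simp add: enat_Suc_le_plus_one_iff C_on_def)
  have u: "Ck_on (Suc m) I ((Omega Q w ^^ k) w)" using Suc m by simp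
  have "Ck_on m I (\<lambda>z. (z, w z))"
    using Ck_on_mono[OF w, of m] by (intro Ck_on_Pair Ck_on_id \<open>open I\<close>) (simp add: m_def)
  then have "Ck_on m I (\<lambda>z. Q (z, w z))"
    using graph Q by (intro Ck_on_compose[OF \<open>open I\<close>, where T = V]) auto
  then have "Ck_on m I (\<lambda>z. deriv ((Omega Q w ^^ k) w) z + Q (z, w z) * (Omega Q w ^^ k) w z)"
    using u Ck_on_Suc_imp[OF u] Ck_on_Suc_real_iff[OF \<open>open I\<close>, of m "(Omega Q w ^^ k) w"]
    by (intro Ck_on_add Ck_on_mult \<open>open I\<close>) auto
  then show ?case by (simp add: m Omega_def[of Q w "(Omega Q w ^^ k) w"])
qed

text \<open>The heart of the matter. With \<open>v\<close> and \<open>u\<close> the \<open>k\<close>-th iterates, the induction hypothesis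
  \<open>v(s z) = \<phi>(z) u(z) / s^k\<close> holds on an open set of \<open>z\<close>, so it may be differentiated; the term with
  \<open>\<phi>'\<close> that appears is exactly the one contributed by \<open>\<phi>'/\<phi>\<close> in \<open>Q\<close>.\<close>

lemma Omega_iter_transform:
  assumes "s \<noteq> 0" and "open I" and w: "Ck_on n I w"
    and V: "C_on r V Q" and "enat n \<le> r + 1"
    and graph: "\<And>z. z \<in> I \<Longrightarrow> (z, w z) \<in> V"
    and \<phi>: "\<And>z. z \<in> I \<Longrightarrow> (\<phi> has_real_derivative deriv \<phi> z) (at z)" "\<And>z. z \<in> I \<Longrightarrow> \<phi> z \<noteq> 0"
    and Q: "\<And>z w. (z, w) \<in> V \<Longrightarrow> Q (z, w) = pullback_parameter s \<phi> F (z, w)"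
    and y: "\<And>z. z \<in> I \<Longrightarrow> y (s * z) = \<phi> z * w z"
  shows "k \<le> n \<Longrightarrow> z \<in> I \<Longrightarrow> (Omega F y ^^ k) y (s * z) = \<phi> z / s ^ k * (Omega Q w ^^ k) w z"
proof (induction k arbitrary: z)
  case 0
  then show ?case using y by simp
next
  case (Suc k)
  define u where "u = (Omega Q w ^^ k) w"
  define v where "v = (Omega F y ^^ k) y"
  have z: "z \<in> I" by fact
  have "Ck_on (Suc (n - Suc k)) I u"
    using Omega_iter_smooth[OF \<open>open I\<close> w V \<open>enat n \<le> r + 1\<close> graph, of k] Suc.prems
    by (simp add: u_def Suc_diff_Suc del: Ck_on.simps)
  then have u: "(u has_real_derivative deriv u z) (at z)"
    using z by (simp add: Ck_on_Suc_real_iff[OF \<open>open I\<close>] del: Ck_on.simps)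
  have chain: "((\<lambda>x. f (x / s)) has_real_derivative D / s) (at (s * z))"
    if "(f has_real_derivative D) (at z)" for f D
    using DERIV_chain2[of f D "\<lambda>x. x / s" "s * z" "1 / s"] that \<open>s \<noteq> 0\<close>
    by (simp add: DERIV_cdivide)
  have "((\<lambda>x. \<phi> (x / s) / s ^ k * u (x / s)) has_real_derivative
      (deriv \<phi> z * u z + \<phi> z * deriv u z) / s ^ Suc k) (at (s * z))"
    using DERIV_mult[OF DERIV_cdivide[OF chain[OF \<phi>(1)[OF z]], of "s ^ k"] chain[OF u]] \<open>s \<noteq> 0\<close>
    by (simp add: field_simps)
  moreover have "open ((\<lambda>x. x / s) -` I)"
    using \<open>open I\<close> \<open>s \<noteq> 0\<close> by (intro continuous_open_vimage) (auto intro!: continuous_intros)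
  moreover have "\<phi> (x / s) / s ^ k * u (x / s) = v x" if "x \<in> (\<lambda>x. x / s) -` I" for x
    using Suc.IH[of "x / s"] Suc.prems that \<open>s \<noteq> 0\<close> by (simp add: u_def v_def)
  ultimately have "(v has_real_derivative (deriv \<phi> z * u z + \<phi> z * deriv u z) / s ^ Suc k) (at (s * z))"
    using z \<open>s \<noteq> 0\<close> by (elim has_field_derivative_transform_within_open) auto
  then have dv: "deriv v (s * z) = (deriv \<phi> z * u z + \<phi> z * deriv u z) / s ^ Suc k"
    by (rule DERIV_imp_deriv)
  have v: "v (s * z) = \<phi> z / s ^ k * u z"
    using Suc by (simp add: u_def v_def)
  have q: "Q (z, w z) = s * F (s * z, y (s * z)) + deriv \<phi> z / \<phi> z"
    using Q[OF graph[OF z]] y[OF z] by (simp add: pullback_parameter_def)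
  have "Omega F y v (s * z) = \<phi> z / s ^ Suc k * Omega Q w u z"
    unfolding Omega_def dv v q using \<phi>(2)[OF z] \<open>s \<noteq> 0\<close> by (simp add: field_simps)
  then show ?case by (simp add: u_def v_def)
qed

lemma transforms_to_pullback_parameter:
  assumes "s \<noteq> 0" and "C_on r V Q" and "enat n \<le> r + 1" and "open J" and "fst ` V \<subseteq> J"
    and "C_on (r + 1) J \<phi>" and "\<And>x. x \<in> J \<Longrightarrow> \<phi> x \<noteq> 0"
    and "\<And>z w. (z, w) \<in> V \<Longrightarrow> Q (z, w) = pullback_parameter s \<phi> F (z, w)"
  shows "transforms_to n V (\<lambda>(z, w). s * z) (\<lambda>(z, w). \<phi> z * w) F Q"
  unfolding transforms_to_def
proof (intro exI conjI allI impI ballI)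
  \<comment> \<open>The factor has to be nonzero even at those \<open>z\<close> outside \<open>J\<close> where \<open>\<phi>\<close> vanishes; no point of the
    graph lies above them.\<close>
  define \<mu> where "\<mu> = (\<lambda>z (j :: real list). if \<phi> z = 0 then 1 else \<phi> z / s ^ n)"
  show "\<mu> z j \<noteq> 0" for z j using \<open>s \<noteq> 0\<close> by (simp add: \<mu>_def)
  fix I w y z
  assume *: "open I \<and> is_interval I \<and> C_on (enat n) I w \<and>
    (\<forall>z\<in>I. (z, w z) \<in> V \<and> deriv (\<lambda>s'. case (s', w s') of (z, w) \<Rightarrow> s * z) z \<noteq> 0 \<and>
       y (case (z, w z) of (z, w) \<Rightarrow> s * z) = (case (z, w z) of (z, w) \<Rightarrow> \<phi> z * w))"
    and "z \<in> I"
  have IJ: "z \<in> J" if "z \<in> I" for z using * that \<open>fst ` V \<subseteq> J\<close> by force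
  have D\<phi>: "(\<phi> has_real_derivative deriv \<phi> z) (at z)" if "z \<in> I" for z
    using \<open>C_on (r + 1) J \<phi>\<close> IJ[OF that] by (simp add: C_on_Suc_real_iff[OF \<open>open J\<close>])
  have "(Omega F y ^^ n) y (s * z) = \<phi> z / s ^ n * (Omega Q w ^^ n) w z"
    by (rule Omega_iter_transform[where V = V and I = I and r = r and n = n])
      (use * assms(1-3,7,8) IJ D\<phi> \<open>z \<in> I\<close> in \<open>auto simp: C_on_def\<close>)
  then show "Omega_iter n F y (case (z, w z) of (z, w) \<Rightarrow> s * z) = \<mu> z (jet n w z) * Omega_iter n Q w z"
    using assms(7)[OF IJ[OF \<open>z \<in> I\<close>]] by (simp add: Omega_iter_def \<mu>_def)
qed

lemma open_fibrewise_preimage: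
  fixes \<phi> :: "real \<Rightarrow> real" and U :: "(real \<times> real) set"
  assumes "open J" and cont: "continuous_on J \<phi>" and "open U"
  shows "open {(z, w). z \<in> J \<and> (s * z, \<phi> z * w) \<in> U}"
proof -
  have "continuous_on (J \<times> (UNIV :: real set)) (\<lambda>p. (s * fst p, \<phi> (fst p) * snd p))"
    by (intro continuous_intros continuous_on_compose2[OF cont]) auto
  then have "open ((J \<times> UNIV) \<inter> (\<lambda>p. (s * fst p, \<phi> (fst p) * snd p)) -` U)"
    using \<open>open J\<close> \<open>open U\<close> by (intro continuous_open_preimage open_Times) auto
  also have "(J \<times> UNIV) \<inter> (\<lambda>p. (s * fst p, \<phi> (fst p) * snd p)) -` U =
      {(z, w). z \<in> J \<and> (s * z, \<phi> z * w) \<in> U}"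
    by auto
  finally show ?thesis .
qed

text \<open>The assumption on \<open>U\<close> says that the inverse \<open>(x, y) \<mapsto> (x/s, y/\<phi>(x/s))\<close> is defined on all of \<open>U\<close>.
  The function \<open>Q\<close> is prescribed on \<open>V\<close> only, so that a closed formula for \<open>Q\<close> need agree with the
  pullback only where the equation defining \<open>\<phi>\<close> holds.\<close>

lemma equivalent_pullback_parameter:
  assumes n: "enat n \<le> r + 1" and "s \<noteq> 0" and "open U" and "open J"
    and \<phi>: "C_on (r + 1) J \<phi>" "\<And>x. x \<in> J \<Longrightarrow> \<phi> x \<noteq> 0"
    and U: "\<And>x y. (x, y) \<in> U \<Longrightarrow> x / s \<in> J"
    and V: "V = {(z, w). z \<in> J \<and> (s * z, \<phi> z * w) \<in> U}"
    and F: "C_on r U F"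
    and Q: "\<And>z w. (z, w) \<in> V \<Longrightarrow> Q (z, w) = pullback_parameter s \<phi> F (z, w)"
  shows "equivalent r n U F V Q"
proof -
  let ?\<rho> = "\<lambda>(z, w). s * z" and ?\<psi> = "\<lambda>(z :: real, w). \<phi> z * w"
  have VJ: "fst ` V \<subseteq> J" using V by auto
  have "open V"
    unfolding V using open_fibrewise_preimage[OF \<open>open J\<close> C_on_imp_continuous_on[OF \<phi>(1)] \<open>open U\<close>] .
  have pb: "C_on r V (pullback_parameter s \<phi> G)" if "C_on r U G" for G
    using C_on_pullback_parameter[OF \<open>open V\<close> \<open>open J\<close> VJ \<phi> _ that] V by auto
  have QC: "C_on r V Q"
    using pb[OF F] C_on_cong[OF \<open>open V\<close>, of Q "pullback_parameter s \<phi> F" r] Q by auto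
  have tr: "transforms_to n V ?\<rho> ?\<psi> G (pullback_parameter s \<phi> G)" if "C_on r U G" for G
    using transforms_to_pullback_parameter[OF \<open>s \<noteq> 0\<close> pb[OF that] n \<open>open J\<close> VJ \<phi>] by simp
  have "bij_betw (\<lambda>p. (?\<rho> p, ?\<psi> p)) V U"
    by (rule bij_betw_byWitness[where f' = "\<lambda>(x, y). (x / s, y / \<phi> (x / s))"])
      (use \<open>s \<noteq> 0\<close> \<phi>(2) U in \<open>auto simp: V\<close>)
  moreover have "jacobian ?\<rho> ?\<psi> p \<noteq> 0" if "p \<in> V" for p
  proof -
    obtain z w where p: "p = (z, w)" by (cases p)
    then have "z \<in> J" using that V by simp
    have "jacobian ?\<rho> ?\<psi> p = s * \<phi> z"
      by (simp add: p jacobian_def)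
    then show ?thesis using \<open>s \<noteq> 0\<close> \<phi>(2)[OF \<open>z \<in> J\<close>] by simp
  qed
  moreover have "C_on (r + 1) V ?\<rho>"
    using C_on_mult[OF \<open>open V\<close> C_on_const[OF \<open>open V\<close>] C_on_fst[OF \<open>open V\<close>], of "r + 1" s]
    by (simp add: case_prod_unfold)
  moreover have "C_on (r + 1) V ?\<psi>"
    using C_on_mult[OF \<open>open V\<close> C_on_comp_fst[OF \<open>open V\<close> VJ \<phi>(1)] C_on_snd[OF \<open>open V\<close>]]
    by (simp add: case_prod_unfold)
  ultimately have "point_transformation (r + 1) V U ?\<rho> ?\<psi>"
    using \<open>open V\<close> \<open>open U\<close> by (simp add: point_transformation_def)
  then have "equivalence_transformation r n V U ?\<rho> ?\<psi>"
    using pb tr by (auto simp: equivalence_transformation_def)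
  moreover have "transforms_to n V ?\<rho> ?\<psi> F Q"
    using transforms_to_pullback_parameter[OF \<open>s \<noteq> 0\<close> QC n \<open>open J\<close> VJ \<phi> Q] .
  ultimately show ?thesis
    using F QC by (auto simp: equivalent_def)
qed

section \<open>Antiderivatives on open sets of reals\<close>

lemma interval_integral_has_real_derivative:
  fixes g :: "real \<Rightarrow> real" and c x :: real
  assumes "open J" and "is_interval J" and g: "continuous_on J g" and "c \<in> J" and "x \<in> J"
  shows "((\<lambda>u. LBINT t=c..u. g t) has_real_derivative g x) (at x)"
proof -
  obtain e where e: "e > 0" "cball x e \<subseteq> J" using \<open>open J\<close> \<open>x \<in> J\<close> open_contains_cball by blast
  \<comment> \<open>A compact interval inside \<open>J\<close> that contains the base point and has \<open>x\<close> in its interior.\<close>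
  define a where "a = min c (x - e)"
  define b where "b = max c (x + e)"
  have "x - e \<in> J" "x + e \<in> J" using e by (auto simp: dist_real_def)
  then have "{a..b} \<subseteq> J"
    using \<open>is_interval J\<close> \<open>c \<in> J\<close> unfolding is_interval_1 a_def b_def
    by (metis atLeastAtMost_iff max_def min_def subsetI)
  then have "((\<lambda>u. LBINT t=c..u. g t) has_vector_derivative g x) (at x within {a..b})"
    using e by (intro interval_integral_FTC2 continuous_on_subset[OF g]) (auto simp: a_def b_def)
  moreover have "x \<in> {a<..<b}" using e by (auto simp: a_def b_def)
  ultimately show ?thesis
    unfolding has_real_derivative_iff_has_vector_derivative
    by (metis at_within_Icc_at greaterThanLessThan_iff)
qed

text \<open>Integrate from a base point chosen in each component; near a given point the base point is
  constant because components of open sets are open.\<close>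

lemma open_real_antiderivative_exists:
  fixes g :: "real \<Rightarrow> real"
  assumes "open J" and g: "continuous_on J g"
  shows "\<exists>\<Phi>. \<forall>x\<in>J. (\<Phi> has_real_derivative g x) (at x)"
proof -
  define base where "base = (\<lambda>C :: real set. SOME c. c \<in> C)"
  define \<Phi> where "\<Phi> = (\<lambda>u. LBINT t=base (connected_component_set J u)..u. g t)"
  have "(\<Phi> has_real_derivative g x) (at x)" if "x \<in> J" for x
  proof -
    let ?C = "connected_component_set J x"
    have C: "open ?C" "is_interval ?C" "?C \<subseteq> J" "x \<in> ?C"
      using that \<open>open J\<close> by (auto simp: open_connected_component is_interval_connected_1
          connected_component_subset)
    have "base ?C \<in> ?C" using C(4) unfolding base_def by (rule someI)
    then have "((\<lambda>u. LBINT t=base ?C..u. g t) has_real_derivative g x) (at x)"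
      using interval_integral_has_real_derivative C continuous_on_subset[OF g] by blast
    moreover have "(LBINT t=base ?C..u. g t) = \<Phi> u" if "u \<in> ?C" for u
      using connected_component_eq[OF that] by (simp add: \<Phi>_def)
    ultimately show ?thesis
      by (rule has_field_derivative_transform_within_open[OF _ C(1,4)])
  qed
  then show ?thesis by blast
qed

section \<open>Particular equivalences\<close>

lemma equivalent_affine_argument:
  assumes "enat n \<le> r + 1" and "open D" and "C_on r D F\<^sub>0" and "\<epsilon> \<noteq> 0" and "c \<noteq> 0"
  shows "equivalent r n
    {(x, y). (a * x + b, c * y + d) \<in> D} (\<lambda>(x, y). \<epsilon> * F\<^sub>0 (a * x + b, c * y + d))
    {(z, w). (b + a * z / \<epsilon>, d + w) \<in> D} (\<lambda>(z, w). F\<^sub>0 (b + a * z / \<epsilon>, d + w))"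
    (is "equivalent r n ?U ?F ?V ?Q")
proof (rule equivalent_pullback_parameter[where s = "1 / \<epsilon>" and J = UNIV and \<phi> = "\<lambda>_. 1 / c"])
  let ?h = "\<lambda>p :: real \<times> real. (a * fst p + b, c * snd p + d)"
  have U: "?U = ?h -` D" by auto
  show oU: "open ?U"
    unfolding U using \<open>open D\<close> by (rule open_vimage) (intro continuous_intros)
  have "C_on r ?U ?h"
    by (intro C_on_Pair C_on_add C_on_mult C_on_const C_on_fst C_on_snd oU)
  then have "C_on r ?U (\<lambda>p. F\<^sub>0 (?h p))"
    using \<open>C_on r D F\<^sub>0\<close> by (intro C_on_compose[OF oU, where T = D]) auto
  then have "C_on r ?U (\<lambda>p. \<epsilon> * F\<^sub>0 (?h p))"
    by (intro C_on_mult C_on_const oU)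
  then show "C_on r ?U ?F" by (simp add: case_prod_unfold)
qed (use assms in \<open>auto simp: pullback_parameter_def C_on_const add.commute\<close>)

text \<open>A linear equation of this class, with \<open>F\<close> depending on \<open>x\<close> alone, loses its coefficient when \<open>y\<close> is
  divided by a nonzero solution \<open>\<phi>\<close> of the first-order equation \<open>\<phi>' + g \<phi> = 0\<close>.\<close>

lemma equivalent_zero:
  assumes "enat n \<le> r + 1" and "open J" and g: "C_on r J g"
  shows "equivalent r n {(x, y). x \<in> J} (\<lambda>(x, y). g x) {(z, w). z \<in> J} (\<lambda>(z, w). 0)"
    (is "equivalent r n ?U _ _ _")
proof -
  obtain \<Phi> where \<Phi>: "\<And>x. x \<in> J \<Longrightarrow> (\<Phi> has_real_derivative g x) (at x)"
    using open_real_antiderivative_exists[OF \<open>open J\<close> C_on_imp_continuous_on[OF g]] by blast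
  define \<phi> where "\<phi> = (\<lambda>x. exp (- \<Phi> x))"
  have \<phi>: "deriv \<phi> x = - g x * \<phi> x" if "x \<in> J" for x
    unfolding \<phi>_def using \<Phi>[OF that] by (auto intro!: DERIV_imp_deriv derivative_eq_intros)
  have \<phi>0: "\<phi> x \<noteq> 0" for x by (simp add: \<phi>_def)
  show ?thesis
  proof (rule equivalent_pullback_parameter[where s = 1 and J = J and \<phi> = \<phi>])
    show "C_on (r + 1) J \<phi>"
      unfolding \<phi>_def using C_on_antiderivative[OF \<open>open J\<close> \<Phi> g]
      by (intro C_on_exp C_on_bounded_linear[OF bounded_linear_minus[OF bounded_linear_ident]] \<open>open J\<close>)
    have U: "?U = J \<times> UNIV" by auto
    show "open ?U" unfolding U using \<open>open J\<close> by (simp add: open_Times)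
    then show "C_on r ?U (\<lambda>(x, y). g x)"
      using C_on_comp_fst[where V = ?U and J = J and f = g] g by (auto simp: case_prod_unfold)
  qed (use assms \<phi> \<phi>0 in \<open>auto simp: pullback_parameter_def\<close>)
qed

text \<open>Here \<open>\<phi>'/\<phi> = -B\<close> cancels \<open>B\<close>, while \<open>A(x) y\<close> becomes \<open>A(z) \<phi>(z) w\<close>. The constant \<open>\<epsilon>\<close> is the free
  initial value of \<open>\<phi>\<close>.\<close>

lemma equivalent_affine_summand:
  fixes J :: "real set" and z\<^sub>0 :: real
  assumes "enat n \<le> r + 1" and "open D" and "C_on r D F\<^sub>0" and "\<epsilon> \<noteq> 0"
    and "open J" and "is_interval J" and "z\<^sub>0 \<in> J" and A: "C_on r J A" and B: "C_on r J B"
  shows "equivalent r n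
    {(x, y). x \<in> J \<and> (x, y) \<in> D} (\<lambda>(x, y). F\<^sub>0 (x, y) + A x * y + B x)
    {(z, w). z \<in> J \<and> (z, \<epsilon> * exp (LBINT t=z\<^sub>0..z. - B t) * w) \<in> D}
    (\<lambda>(z, w). F\<^sub>0 (z, \<epsilon> * exp (LBINT t=z\<^sub>0..z. - B t) * w)
             + \<epsilon> * exp (LBINT t=z\<^sub>0..z. - B t) * A z * w)"
    (is "equivalent r n ?U ?F ?V ?Q")
proof -
  define \<beta> where "\<beta> = (\<lambda>z. LBINT t=z\<^sub>0..z. - B t)"
  define \<phi> where "\<phi> = (\<lambda>z. \<epsilon> * exp (\<beta> z))"
  have B': "C_on r J (\<lambda>t. - B t)"
    using C_on_bounded_linear[OF bounded_linear_minus[OF bounded_linear_ident] \<open>open J\<close> B] .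
  have \<beta>: "(\<beta> has_real_derivative - B z) (at z)" if "z \<in> J" for z
    unfolding \<beta>_def using that assms(5-7) C_on_imp_continuous_on[OF B']
    by (intro interval_integral_has_real_derivative[of J "\<lambda>t. - B t"])
  have \<phi>: "deriv \<phi> z = - B z * \<phi> z" if "z \<in> J" for z
    unfolding \<phi>_def using \<beta>[OF that] by (auto intro!: DERIV_imp_deriv derivative_eq_intros)
  have \<phi>0: "\<phi> z \<noteq> 0" for z using \<open>\<epsilon> \<noteq> 0\<close> by (simp add: \<phi>_def)
  have "equivalent r n ?U ?F {(z, w). z \<in> J \<and> (z, \<phi> z * w) \<in> D}
      (\<lambda>(z, w). F\<^sub>0 (z, \<phi> z * w) + \<phi> z * A z * w)"
  proof (rule equivalent_pullback_parameter[where s = 1 and J = J and \<phi> = \<phi>])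
    show "C_on (r + 1) J \<phi>"
      unfolding \<phi>_def using C_on_antiderivative[OF \<open>open J\<close> \<beta> B']
      by (intro C_on_mult C_on_const C_on_exp \<open>open J\<close>)
    have U: "?U = J \<times> UNIV \<inter> D" by auto
    show oU: "open ?U" unfolding U using \<open>open J\<close> \<open>open D\<close> by (intro open_Int open_Times) auto
    have "C_on r ?U F\<^sub>0"
      using \<open>C_on r D F\<^sub>0\<close> by (rule C_on_subset) auto
    moreover have "C_on r ?U (\<lambda>p. A (fst p))" "C_on r ?U (\<lambda>p. B (fst p))"
      using A B by (auto intro!: C_on_comp_fst[OF oU, where J = J])
    ultimately have "C_on r ?U (\<lambda>p. F\<^sub>0 p + A (fst p) * snd p + B (fst p))"
      by (intro C_on_add C_on_mult C_on_snd oU)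
    then show "C_on r ?U ?F" by (simp add: case_prod_unfold)
  qed (use assms \<phi> \<phi>0 in \<open>auto simp: pullback_parameter_def field_simps\<close>)
  then show ?thesis by (simp add: \<phi>_def \<beta>_def)
qed

text \<open>For \<open>\<phi> = 1/A\<close> one has \<open>A y = w\<close> and \<open>\<phi>'/\<phi> = -A'/A\<close>. As \<open>A'\<close> enters the new parameter function, \<open>A\<close>
  has to be one degree smoother than \<open>F\<^sub>0\<close>.\<close>

lemma equivalent_rescaled_argument:
  assumes "enat n \<le> r + 1" and "open D" and "C_on r D F\<^sub>0"
    and "open J" and A: "C_on (r + 1) J A" "\<And>x. x \<in> J \<Longrightarrow> A x \<noteq> 0"
  shows "equivalent r n
    {(x, y). x \<in> J \<and> (x, A x * y) \<in> D} (\<lambda>(x, y). F\<^sub>0 (x, A x * y))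
    {(z, w). z \<in> J \<and> (z, w) \<in> D} (\<lambda>(z, w). F\<^sub>0 (z, w) - deriv A z / A z)"
    (is "equivalent r n ?U ?F ?V ?Q")
proof (rule equivalent_pullback_parameter[where s = 1 and J = J and \<phi> = "\<lambda>x. inverse (A x)"])
  show "C_on (r + 1) J (\<lambda>x. inverse (A x))"
    using C_on_inverse[OF \<open>open J\<close> A] .
  show oU: "open ?U"
    using open_fibrewise_preimage[OF \<open>open J\<close> C_on_imp_continuous_on[OF A(1)] \<open>open D\<close>, of 1] by simp
  have "C_on r J A" using A(1) by (rule C_on_mono) (simp add: add_increasing2)
  then have "C_on r ?U (\<lambda>p. (fst p, A (fst p) * snd p))"
    by (intro C_on_Pair C_on_mult C_on_fst C_on_snd C_on_comp_fst[where J = J] oU) auto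
  then have "C_on r ?U (\<lambda>p. F\<^sub>0 (fst p, A (fst p) * snd p))"
    using \<open>C_on r D F\<^sub>0\<close> by (intro C_on_compose[OF oU, where T = D]) auto
  then show "C_on r ?U ?F" by (simp add: case_prod_unfold)
  have A': "deriv (\<lambda>x. inverse (A x)) z = - deriv A z / (A z)\<^sup>2" if "z \<in> J" for z
  proof -
    have "(A has_real_derivative deriv A z) (at z)"
      using A(1) that by (simp add: C_on_Suc_real_iff[OF \<open>open J\<close>])
    from DERIV_inverse_fun[OF this A(2)[OF that]] show ?thesis
      by (auto intro!: DERIV_imp_deriv simp: field_simps power2_eq_square)
  qed
  show "?Q (z, w) = pullback_parameter 1 (\<lambda>x. inverse (A x)) ?F (z, w)" if "(z, w) \<in> ?V" for z w
    using that A(2)[of z] A'[of z] by (auto simp: pullback_parameter_def field_simps power2_eq_square)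
  show "?V = {(z, w). z \<in> J \<and> (1 * z, inverse (A z) * w) \<in> ?U}"
    using A(2) by (auto simp: mult.assoc[symmetric])
qed (use assms in auto)

theorem corollary1:
  fixes n :: nat and r :: enat and D :: "(real \<times> real) set" and F\<^sub>0 :: "real \<times> real \<Rightarrow> real"
    and \<epsilon> a b c d :: real
  assumes "n \<ge> 2" and "enat n \<le> r + 1"
    and "open D" and "C_on r D F\<^sub>0" and "\<epsilon> \<noteq> 0"
  shows
    "(c \<noteq> 0 \<longrightarrow>
        equivalent r n
          {(x, y). (a * x + b, c * y + d) \<in> D} (\<lambda>(x, y). \<epsilon> * F\<^sub>0 (a * x + b, c * y + d))
          {(z, w). (b + a * z / \<epsilon>, d + w) \<in> D} (\<lambda>(z, w). F\<^sub>0 (b + a * z / \<epsilon>, d + w))) \<and>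
     (c = 0 \<longrightarrow>
        equivalent r n
          {(x, y). (a * x + b, c * y + d) \<in> D} (\<lambda>(x, y). \<epsilon> * F\<^sub>0 (a * x + b, c * y + d))
          {(z, w). (a * z + b, c * w + d) \<in> D} (\<lambda>(z, w). 0)) \<and>
     (\<forall>(J :: real set) (z\<^sub>0 :: real) (A :: real \<Rightarrow> real) (B :: real \<Rightarrow> real).
        open J \<and> is_interval J \<and> z\<^sub>0 \<in> J \<and> C_on r J A \<and> C_on r J B \<longrightarrow>
        equivalent r n
          {(x, y). x \<in> J \<and> (x, y) \<in> D} (\<lambda>(x, y). F\<^sub>0 (x, y) + A x * y + B x)
          {(z, w). z \<in> J \<and> (z, \<epsilon> * exp (LBINT t=z\<^sub>0..z. - B t) * w) \<in> D}
          (\<lambda>(z, w). F\<^sub>0 (z, \<epsilon> * exp (LBINT t=z\<^sub>0..z. - B t) * w)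
                   + \<epsilon> * exp (LBINT t=z\<^sub>0..z. - B t) * A z * w)) \<and>
     (\<forall>(J :: real set) (A :: real \<Rightarrow> real).
        open J \<and> C_on (r + 1) J A \<and> (\<forall>x\<in>J. A x \<noteq> 0) \<longrightarrow>
        equivalent r n
          {(x, y). x \<in> J \<and> (x, A x * y) \<in> D} (\<lambda>(x, y). F\<^sub>0 (x, A x * y))
          {(z, w). z \<in> J \<and> (z, w) \<in> D} (\<lambda>(z, w). F\<^sub>0 (z, w) - deriv A z / A z))"
proof (intro conjI impI allI)
  assume "c \<noteq> 0"
  then show "equivalent r n
      {(x, y). (a * x + b, c * y + d) \<in> D} (\<lambda>(x, y). \<epsilon> * F\<^sub>0 (a * x + b, c * y + d))
      {(z, w). (b + a * z / \<epsilon>, d + w) \<in> D} (\<lambda>(z, w). F\<^sub>0 (b + a * z / \<epsilon>, d + w))"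
    using equivalent_affine_argument[OF assms(2-5)] by blast
next
  assume "c = 0"
  \<comment> \<open>The parameter function no longer depends on \<open>y\<close>, and its domain is a product with base \<open>J\<close>.\<close>
  define J where "J = {x. (a * x + b, d) \<in> D}"
  have "open J"
    unfolding J_def using \<open>open D\<close>
    by (intro open_vimage[of D "\<lambda>x. (a * x + b, d)", unfolded vimage_def] continuous_intros)
  then have "C_on r J (\<lambda>x. (a * x + b, d))"
    by (intro C_on_Pair C_on_add C_on_mult C_on_const C_on_id)
  then have "C_on r J (\<lambda>x. F\<^sub>0 (a * x + b, d))"
    using \<open>C_on r D F\<^sub>0\<close> by (intro C_on_compose[OF \<open>open J\<close>, where T = D]) (auto simp: J_def)
  then have "C_on r J (\<lambda>x. \<epsilon> * F\<^sub>0 (a * x + b, d))"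
    using \<open>open J\<close> by (intro C_on_mult C_on_const)
  then show "equivalent r n
      {(x, y). (a * x + b, c * y + d) \<in> D} (\<lambda>(x, y). \<epsilon> * F\<^sub>0 (a * x + b, c * y + d))
      {(z, w). (a * z + b, c * w + d) \<in> D} (\<lambda>(z, w). 0)"
    using equivalent_zero[OF assms(2) \<open>open J\<close>] \<open>c = 0\<close> by (simp add: J_def)
next
  fix J :: "real set" and z\<^sub>0 :: real and A B :: "real \<Rightarrow> real"
  assume "open J \<and> is_interval J \<and> z\<^sub>0 \<in> J \<and> C_on r J A \<and> C_on r J B"
  then show "equivalent r n
      {(x, y). x \<in> J \<and> (x, y) \<in> D} (\<lambda>(x, y). F\<^sub>0 (x, y) + A x * y + B x)
      {(z, w). z \<in> J \<and> (z, \<epsilon> * exp (LBINT t=z\<^sub>0..z. - B t) * w) \<in> D}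
      (\<lambda>(z, w). F\<^sub>0 (z, \<epsilon> * exp (LBINT t=z\<^sub>0..z. - B t) * w)
               + \<epsilon> * exp (LBINT t=z\<^sub>0..z. - B t) * A z * w)"
    by (intro equivalent_affine_summand assms(2-5)) simp_all
next
  fix J :: "real set" and A :: "real \<Rightarrow> real"
  assume "open J \<and> C_on (r + 1) J A \<and> (\<forall>x\<in>J. A x \<noteq> 0)"
  then show "equivalent r n
      {(x, y). x \<in> J \<and> (x, A x * y) \<in> D} (\<lambda>(x, y). F\<^sub>0 (x, A x * y))
      {(z, w). z \<in> J \<and> (z, w) \<in> D} (\<lambda>(z, w). F\<^sub>0 (z, w) - deriv A z / A z)"
    by (intro equivalent_rescaled_argument assms(2-4)) simp_all
qed

end
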